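(* Let $\mathcal A=(A,\cdot,\diamond,\varepsilon)$ be an admissible Novikov-Poisson color Hom-algebra and let $\alpha:\mathcal A\to\mathcal A$ be a morphism of admissible Novikov-Poisson color Hom-algebras. Define $\cdot_\alpha,\diamond_\alpha:A\times A\to A$, for all $x,y\in\mathcal H(A)$, by $x\cdot_\alpha y=\alpha(x\cdot y)$ and $x\diamond_\alpha y=\alpha(x\diamond y)$. Then $\mathcal A_\alpha=(A,\cdot_\alpha,\diamond_\alpha,\varepsilon,\alpha)$ is an admissible Hom-Novikov-Poisson color Hom-algebra.
   Context: $\mathbb K$ is an algebraically closed field of characteristic $0$; all spaces are over $\mathbb K$. $\Gamma$ is an abelian group and $\varepsilon:\Gamma\times\Gamma\to\mathbb K^*=\mathbb K\setminus\{0\}$ is a commutation factor: $\varepsilon(a,b)\varepsilon(b,a)=1$, $\varepsilon(a,b+c)=\varepsilon(a,b)\varepsilon(a,c)$, $\varepsilon(a+b,c)=\varepsilon(a,c)\varepsilon(b,c)$. For a $\Gamma$-graded linear space $V$, $\mathcal H(V)$ is the set of homogeneous elements; inside $\varepsilon$ a homogeneous element stands for its degree (so $\varepsilon(x+y,z)=\varepsilon(\deg x+\deg y,\deg z)$). A linear map is even if it preserves degrees; a bilinear multiplication on $A$ is even if $A_\gamma A_{\gamma'}\subseteq A_{\gamma+\gamma'}$. A color Hom-algebra $(A,\cdot,\varepsilon,\alpha)$ is a $\Gamma$-graded space $A$ with an even bilinear multiplication $\cdot$ and an even linear map $\alpha:A\to A$ (not assumed multiplicative). All identities are for all homogeneous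 $x,y,z$. $\varepsilon$-commutative Hom-associative color Hom-algebra $(A,\cdot,\varepsilon,\alpha)$: a color Hom-algebra with $\alpha(x)\cdot(y\cdot z)=(x\cdot y)\cdot\alpha(z)$ and $x\cdot y=\varepsilon(x,y)y\cdot x$. Hom-Novikov color Hom-algebra $(A,\diamond,\varepsilon,\alpha)$: a color Hom-algebra with $(x\diamond y)\diamond\alpha(z)-\alpha(x)\diamond(y\diamond z)=\varepsilon(x,y)\big((y\diamond x)\diamond\alpha(z)-\alpha(y)\diamond(x\diamond z)\big)$ and $(x\diamond y)\diamond\alpha(z)=\varepsilon(y,z)(x\diamond z)\diamond\alpha(y)$. Hom-Novikov-Poisson color Hom-algebra $(A,\cdot,\diamond,\varepsilon,\alpha)$: $(A,\cdot,\varepsilon,\alpha)$ is $\varepsilon$-commutative Hom-associative, $(A,\diamond,\varepsilon,\alpha)$ is Hom-Novikov, and $(x\cdot y)\diamond\alpha(z)=\varepsilon(y,z)(x\diamond z)\cdot\alpha(y)$, $(x\diamond y)\cdot\alpha(z)-\alpha(x)\diamond(y\cdot z)=\varepsilon(x,y)\big((y\diamond x)\cdot\alpha(z)-\alpha(y)\diamond(x\cdot z)\big)$. Hom-Lie color Hom-algebra $(A,[\cdot,\cdot],\varepsilon,\alpha)$: $[\cdot,\cdot]$ even bilinear, $\alpha$ even linear, $[x,y]=-\varepsilon(x,y)[y,x]$ and $\circlearrowleft_{x,y,z}\varepsilon(z,x)[\alpha(x),[y,z]]=0$ (cyclic sum over $(x,y,z)$). Hom-Poisson color Hom-algebra $(A,\cdot,[\cdot,\cdot],\varepsilon,\alpha)$: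 $(A,\cdot,\varepsilon,\alpha)$ is $\varepsilon$-commutative Hom-associative, $(A,[\cdot,\cdot],\varepsilon,\alpha)$ is Hom-Lie, and $[\alpha(x),y\cdot z]=\varepsilon(x,y)\alpha(y)\cdot[x,z]+\varepsilon(x+y,z)\alpha(z)\cdot[x,y]$. A Hom-Novikov-Poisson color Hom-algebra $(A,\cdot,\diamond,\varepsilon,\alpha)$ is admissible if $(A,\cdot,[\cdot,\cdot],\varepsilon,\alpha)$ with $[x,y]=x\diamond y-\varepsilon(x,y)y\diamond x$ is a Hom-Poisson color Hom-algebra. An (admissible) Novikov-Poisson color Hom-algebra $(A,\cdot,\diamond,\varepsilon)$ is an (admissible) Hom-Novikov-Poisson color Hom-algebra with twisting map $\mathrm{id}_A$. A morphism of such is an even linear map $f$ with $f(x\cdot y)=f(x)\cdot f(y)$ and $f(x\diamond y)=f(x)\diamond f(y)$. *)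

theory Defs
  imports Complex_Main "HOL-Computational_Algebra.Polynomial"
begin

definition commutation_factor ::
  "('g::ab_group_add \<Rightarrow> 'g \<Rightarrow> 'k::field) \<Rightarrow> bool" where
  "commutation_factor eps \<longleftrightarrow>
     (\<forall>a b. eps a b \<noteq> 0) \<and>
     (\<forall>a b. eps a b * eps b a = 1) \<and>
     (\<forall>a b c. eps a (b + c) = eps a b * eps a c) \<and>
     (\<forall>a b c. eps (a + b) c = eps a c * eps b c)"

(* f is the family of homogeneous components of x. *)
definition homogeneous_decomposition ::
  "('g \<Rightarrow> 'a::ab_group_add set) \<Rightarrow> 'a \<Rightarrow> ('g \<Rightarrow> 'a) \<Rightarrow> bool" where
  "homogeneous_decomposition A x f \<longleftrightarrow>
     (\<forall>a. f a \<in> A a) \<and> finite {a. f a \<noteq> 0} \<and> x = (\<Sum>a | f a \<noteq> 0. f a)"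

(* The whole type 'a is the space; A a is its component of degree a. *)
definition graded_space ::
  "('k::field \<Rightarrow> 'a::ab_group_add \<Rightarrow> 'a) \<Rightarrow> ('g \<Rightarrow> 'a set) \<Rightarrow> bool" where
  "graded_space scale A \<longleftrightarrow>
     vector_space scale \<and>
     (\<forall>a. module.subspace scale (A a)) \<and>
     (\<forall>x. \<exists>!f. homogeneous_decomposition A x f)"

definition component :: "('g \<Rightarrow> 'a::ab_group_add set) \<Rightarrow> 'g \<Rightarrow> 'a \<Rightarrow> 'a" where
  "component A a x = (THE f. homogeneous_decomposition A x f) a"

definition even_linear ::
  "('k::field \<Rightarrow> 'a::ab_group_add \<Rightarrow> 'a) \<Rightarrow> ('g \<Rightarrow> 'a set) \<Rightarrow>
   ('k \<Rightarrow> 'b::ab_group_add \<Rightarrow> 'b) \<Rightarrow> ('g \<Rightarrow> 'b set) \<Rightarrow> ('a \<Rightarrow> 'b) \<Rightarrow> bool" where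
  "even_linear scale A scale' A' f \<longleftrightarrow>
     Vector_Spaces.linear scale scale' f \<and> (\<forall>a. \<forall>x\<in>A a. f x \<in> A' a)"

definition even_bilinear ::
  "('k::field \<Rightarrow> 'a::ab_group_add \<Rightarrow> 'a) \<Rightarrow> ('g::ab_group_add \<Rightarrow> 'a set) \<Rightarrow>
   ('a \<Rightarrow> 'a \<Rightarrow> 'a) \<Rightarrow> bool" where
  "even_bilinear scale A m \<longleftrightarrow>
     (\<forall>x. Vector_Spaces.linear scale scale (\<lambda>y. m x y)) \<and>
     (\<forall>y. Vector_Spaces.linear scale scale (\<lambda>x. m x y)) \<and>
     (\<forall>a b. \<forall>x\<in>A a. \<forall>y\<in>A b. m x y \<in> A (a + b))"

definition color_hom_algebra ::
  "('k::field \<Rightarrow> 'a::ab_group_add \<Rightarrow> 'a) \<Rightarrow> ('g::ab_group_add \<Rightarrow> 'a set) \<Rightarrow>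
   ('a \<Rightarrow> 'a \<Rightarrow> 'a) \<Rightarrow> ('g \<Rightarrow> 'g \<Rightarrow> 'k) \<Rightarrow> ('a \<Rightarrow> 'a) \<Rightarrow> bool" where
  "color_hom_algebra scale A m eps \<alpha> \<longleftrightarrow>
     graded_space scale A \<and> commutation_factor eps \<and>
     even_bilinear scale A m \<and> even_linear scale A scale A \<alpha>"

(* In the identities below, x, y, z are homogeneous of degrees a, b, c. The zero vector
   lies in every A a; the identities hold trivially as soon as one argument is zero. *)

definition comm_hom_assoc_color_hom_algebra ::
  "('k::field \<Rightarrow> 'a::ab_group_add \<Rightarrow> 'a) \<Rightarrow> ('g::ab_group_add \<Rightarrow> 'a set) \<Rightarrow>
   ('a \<Rightarrow> 'a \<Rightarrow> 'a) \<Rightarrow> ('g \<Rightarrow> 'g \<Rightarrow> 'k) \<Rightarrow> ('a \<Rightarrow> 'a) \<Rightarrow> bool" where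
  "comm_hom_assoc_color_hom_algebra scale A m eps \<alpha> \<longleftrightarrow>
     color_hom_algebra scale A m eps \<alpha> \<and>
     (\<forall>a b c. \<forall>x\<in>A a. \<forall>y\<in>A b. \<forall>z\<in>A c. m (\<alpha> x) (m y z) = m (m x y) (\<alpha> z)) \<and>
     (\<forall>a b. \<forall>x\<in>A a. \<forall>y\<in>A b. m x y = scale (eps a b) (m y x))"

definition hom_novikov_color_hom_algebra ::
  "('k::field \<Rightarrow> 'a::ab_group_add \<Rightarrow> 'a) \<Rightarrow> ('g::ab_group_add \<Rightarrow> 'a set) \<Rightarrow>
   ('a \<Rightarrow> 'a \<Rightarrow> 'a) \<Rightarrow> ('g \<Rightarrow> 'g \<Rightarrow> 'k) \<Rightarrow> ('a \<Rightarrow> 'a) \<Rightarrow> bool" where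
  "hom_novikov_color_hom_algebra scale A d eps \<alpha> \<longleftrightarrow>
     color_hom_algebra scale A d eps \<alpha> \<and>
     (\<forall>a b c. \<forall>x\<in>A a. \<forall>y\<in>A b. \<forall>z\<in>A c.
        d (d x y) (\<alpha> z) - d (\<alpha> x) (d y z) =
        scale (eps a b) (d (d y x) (\<alpha> z) - d (\<alpha> y) (d x z))) \<and>
     (\<forall>a b c. \<forall>x\<in>A a. \<forall>y\<in>A b. \<forall>z\<in>A c.
        d (d x y) (\<alpha> z) = scale (eps b c) (d (d x z) (\<alpha> y)))"

definition hom_novikov_poisson_color_hom_algebra ::
  "('k::field \<Rightarrow> 'a::ab_group_add \<Rightarrow> 'a) \<Rightarrow> ('g::ab_group_add \<Rightarrow> 'a set) \<Rightarrow>
   ('a \<Rightarrow> 'a \<Rightarrow> 'a) \<Rightarrow> ('a \<Rightarrow> 'a \<Rightarrow> 'a) \<Rightarrow> ('g \<Rightarrow> 'g \<Rightarrow> 'k) \<Rightarrow> ('a \<Rightarrow> 'a) \<Rightarrow> bool" where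
  "hom_novikov_poisson_color_hom_algebra scale A m d eps \<alpha> \<longleftrightarrow>
     comm_hom_assoc_color_hom_algebra scale A m eps \<alpha> \<and>
     hom_novikov_color_hom_algebra scale A d eps \<alpha> \<and>
     (\<forall>a b c. \<forall>x\<in>A a. \<forall>y\<in>A b. \<forall>z\<in>A c.
        d (m x y) (\<alpha> z) = scale (eps b c) (m (d x z) (\<alpha> y))) \<and>
     (\<forall>a b c. \<forall>x\<in>A a. \<forall>y\<in>A b. \<forall>z\<in>A c.
        m (d x y) (\<alpha> z) - d (\<alpha> x) (m y z) =
        scale (eps a b) (m (d y x) (\<alpha> z) - d (\<alpha> y) (m x z)))"

definition hom_lie_color_hom_algebra ::
  "('k::field \<Rightarrow> 'a::ab_group_add \<Rightarrow> 'a) \<Rightarrow> ('g::ab_group_add \<Rightarrow> 'a set) \<Rightarrow>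
   ('a \<Rightarrow> 'a \<Rightarrow> 'a) \<Rightarrow> ('g \<Rightarrow> 'g \<Rightarrow> 'k) \<Rightarrow> ('a \<Rightarrow> 'a) \<Rightarrow> bool" where
  "hom_lie_color_hom_algebra scale A br eps \<alpha> \<longleftrightarrow>
     color_hom_algebra scale A br eps \<alpha> \<and>
     (\<forall>a b. \<forall>x\<in>A a. \<forall>y\<in>A b. br x y = - scale (eps a b) (br y x)) \<and>
     (\<forall>a b c. \<forall>x\<in>A a. \<forall>y\<in>A b. \<forall>z\<in>A c.
        scale (eps c a) (br (\<alpha> x) (br y z)) +
        scale (eps a b) (br (\<alpha> y) (br z x)) +
        scale (eps b c) (br (\<alpha> z) (br x y)) = 0)"

definition hom_poisson_color_hom_algebra ::
  "('k::field \<Rightarrow> 'a::ab_group_add \<Rightarrow> 'a) \<Rightarrow> ('g::ab_group_add \<Rightarrow> 'a set) \<Rightarrow>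
   ('a \<Rightarrow> 'a \<Rightarrow> 'a) \<Rightarrow> ('a \<Rightarrow> 'a \<Rightarrow> 'a) \<Rightarrow> ('g \<Rightarrow> 'g \<Rightarrow> 'k) \<Rightarrow> ('a \<Rightarrow> 'a) \<Rightarrow> bool" where
  "hom_poisson_color_hom_algebra scale A m br eps \<alpha> \<longleftrightarrow>
     comm_hom_assoc_color_hom_algebra scale A m eps \<alpha> \<and>
     hom_lie_color_hom_algebra scale A br eps \<alpha> \<and>
     (\<forall>a b c. \<forall>x\<in>A a. \<forall>y\<in>A b. \<forall>z\<in>A c.
        br (\<alpha> x) (m y z) =
        scale (eps a b) (m (\<alpha> y) (br x z)) + scale (eps (a + b) c) (m (\<alpha> z) (br x y)))"

(* The bilinear extension to the whole space of the bracket
   d x y - eps(x,y) d y x of homogeneous x, y. *)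
definition color_commutator ::
  "('k::field \<Rightarrow> 'a::ab_group_add \<Rightarrow> 'a) \<Rightarrow> ('g::ab_group_add \<Rightarrow> 'a set) \<Rightarrow>
   ('a \<Rightarrow> 'a \<Rightarrow> 'a) \<Rightarrow> ('g \<Rightarrow> 'g \<Rightarrow> 'k) \<Rightarrow> 'a \<Rightarrow> 'a \<Rightarrow> 'a" where
  "color_commutator scale A d eps x y =
     (\<Sum>a | component A a x \<noteq> 0. \<Sum>b | component A b y \<noteq> 0.
        d (component A a x) (component A b y)
        - scale (eps a b) (d (component A b y) (component A a x)))"

definition admissible_hom_novikov_poisson_color_hom_algebra ::
  "('k::field \<Rightarrow> 'a::ab_group_add \<Rightarrow> 'a) \<Rightarrow> ('g::ab_group_add \<Rightarrow> 'a set) \<Rightarrow>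
   ('a \<Rightarrow> 'a \<Rightarrow> 'a) \<Rightarrow> ('a \<Rightarrow> 'a \<Rightarrow> 'a) \<Rightarrow> ('g \<Rightarrow> 'g \<Rightarrow> 'k) \<Rightarrow> ('a \<Rightarrow> 'a) \<Rightarrow> bool" where
  "admissible_hom_novikov_poisson_color_hom_algebra scale A m d eps \<alpha> \<longleftrightarrow>
     hom_novikov_poisson_color_hom_algebra scale A m d eps \<alpha> \<and>
     hom_poisson_color_hom_algebra scale A m (color_commutator scale A d eps) eps \<alpha>"

definition admissible_novikov_poisson_color_hom_algebra ::
  "('k::field \<Rightarrow> 'a::ab_group_add \<Rightarrow> 'a) \<Rightarrow> ('g::ab_group_add \<Rightarrow> 'a set) \<Rightarrow>
   ('a \<Rightarrow> 'a \<Rightarrow> 'a) \<Rightarrow> ('a \<Rightarrow> 'a \<Rightarrow> 'a) \<Rightarrow> ('g \<Rightarrow> 'g \<Rightarrow> 'k) \<Rightarrow> bool" where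
  "admissible_novikov_poisson_color_hom_algebra scale A m d eps \<longleftrightarrow>
     admissible_hom_novikov_poisson_color_hom_algebra scale A m d eps id"

definition novikov_poisson_morphism ::
  "('k::field \<Rightarrow> 'a::ab_group_add \<Rightarrow> 'a) \<Rightarrow> ('g \<Rightarrow> 'a set) \<Rightarrow>
   ('a \<Rightarrow> 'a \<Rightarrow> 'a) \<Rightarrow> ('a \<Rightarrow> 'a \<Rightarrow> 'a) \<Rightarrow>
   ('k \<Rightarrow> 'b::ab_group_add \<Rightarrow> 'b) \<Rightarrow> ('g \<Rightarrow> 'b set) \<Rightarrow>
   ('b \<Rightarrow> 'b \<Rightarrow> 'b) \<Rightarrow> ('b \<Rightarrow> 'b \<Rightarrow> 'b) \<Rightarrow> ('a \<Rightarrow> 'b) \<Rightarrow> bool" where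
  "novikov_poisson_morphism scale A m d scale' A' m' d' f \<longleftrightarrow>
     even_linear scale A scale' A' f \<and>
     (\<forall>x y. f (m x y) = m' (f x) (f y)) \<and>
     (\<forall>x y. f (d x y) = d' (f x) (f y))"

lemma component_homogeneous:
  assumes "graded_space scale A" and "x \<in> A a"
  shows "component A b x = (if b = a then x else 0)"
proof -
  interpret vector_space scale
    using assms(1) by (simp add: graded_space_def)
  have zero: "0 \<in> A b" for b
    using assms(1) by (auto simp: graded_space_def subspace_def)
  let ?f = "\<lambda>b. if b = a then x else 0"
  have supp: "{b. ?f b \<noteq> 0} = (if x = 0 then {} else {a})"
    by auto
  have "homogeneous_decomposition A x ?f"
    unfolding homogeneous_decomposition_def supp using zero assms(2) by auto
  moreover have "\<exists>!f. homogeneous_decomposition A x f"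
    using assms(1) by (simp add: graded_space_def)
  ultimately have "(THE f. homogeneous_decomposition A x f) = ?f"
    by (metis the1_equality)
  then show ?thesis
    by (simp add: component_def)
qed

lemma color_commutator_homogeneous:
  assumes "graded_space scale A" and "even_bilinear scale A d" and "x \<in> A a" and "y \<in> A b"
  shows "color_commutator scale A d eps x y = d x y - scale (eps a b) (d y x)"
proof -
  interpret vector_space scale
    using assms(1) by (simp add: graded_space_def)
  have lin: "Vector_Spaces.linear scale scale (d u)"
    "Vector_Spaces.linear scale scale (\<lambda>v. d v u)" for u
    using assms(2) by (auto simp: even_bilinear_def)
  have zero: "d u 0 = 0" "d 0 u = 0" for u
    using lin[of u] by (auto dest: module_hom.zero simp: Vector_Spaces.linear_def)
  have supp: "{c. component A c v \<noteq> 0} = (if v = 0 then {} else {e})"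
    if "v \<in> A e" for v e
    using component_homogeneous[OF assms(1) that] by auto
  show ?thesis
    unfolding color_commutator_def supp[OF assms(3)] supp[OF assms(4)]
    by (simp add: zero component_homogeneous[OF assms(1,3)] component_homogeneous[OF assms(1,4)])
qed

end

(* Substituting the twisted operations into any of the defining identities and
   pulling the morphism \<alpha> outwards turns both sides into \<alpha> \<circ> \<alpha> applied to the
   two sides of the untwisted identity.  The commutator bracket of the twisted
   product is \<alpha> composed with the old bracket, and \<alpha> is multiplicative for that
   bracket on homogeneous elements, so the Hom-Poisson axioms twist as well. *)
theory Submission
  imports Defs
begin

text \<open>Restricted to homogeneous arguments because the axioms quantify only over these, and
  because the commutator bracket has its closed formula only there.\<close>

definition homogeneous_multiplicative ::
  "('g \<Rightarrow> 'a set) \<Rightarrow> ('a \<Rightarrow> 'a \<Rightarrow> 'a) \<Rightarrow> ('a \<Rightarrow> 'a) \<Rightarrow> bool" where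
  "homogeneous_multiplicative A m f \<longleftrightarrow>
     (\<forall>a b. \<forall>x\<in>A a. \<forall>y\<in>A b. f (m x y) = m (f x) (f y))"

text \<open>Since \<open>q\<close> is even, the inner product of homogeneous elements is again
  homogeneous, so multiplicativity for the outer \<open>p\<close> applies to it. Keeping
  \<open>p\<close> and \<open>q\<close> separate covers the axioms that mix two operations.\<close>

lemma homogeneous_multiplicative_nested:
  assumes "homogeneous_multiplicative A p f" and "even_bilinear scale A q"
    and "x \<in> A a" and "y \<in> A b" and "z \<in> A c"
  shows "p (f x) (f (q y z)) = f (p x (q y z))"
    and "p (f (q x y)) (f z) = f (p (q x y) z)"
proof -
  have "q y z \<in> A (b + c)" "q x y \<in> A (a + b)"
    using assms(2-5) by (simp_all add: even_bilinear_def)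
  then show "p (f x) (f (q y z)) = f (p x (q y z))"
    and "p (f (q x y)) (f z) = f (p (q x y) z)"
    using assms(1,3,5) unfolding homogeneous_multiplicative_def by metis+
qed

text \<open>Only \<alpha> is fixed: the operations remain parameters, so that the same lemmas serve
  \<open>m\<close>, \<open>d\<close> and the bracket. The sublocale supplies the linearity rules
  \<open>add\<close>, \<open>diff\<close>, \<open>neg\<close>, \<open>scale\<close>,
  \<open>sum\<close> and \<open>zero\<close>.\<close>

locale even_endomorphism =
  fixes scale :: "'k::field \<Rightarrow> 'a::ab_group_add \<Rightarrow> 'a"
    and A :: "'g::ab_group_add \<Rightarrow> 'a set"
    and \<alpha> :: "'a \<Rightarrow> 'a"
  assumes even_linear: "even_linear scale A scale A \<alpha>"
begin

sublocale Vector_Spaces.linear scale scale \<alpha>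
  using even_linear by (simp add: even_linear_def)

lemma twist_color_hom_algebra:
  assumes "color_hom_algebra scale A m eps id"
  shows "color_hom_algebra scale A (\<lambda>x y. \<alpha> (m x y)) eps \<alpha>"
proof -
  \<comment> \<open>Used for both slots of the product: fixing either argument leaves a linear map
    followed by \<alpha>.\<close>
  have "Vector_Spaces.linear scale scale (\<lambda>y. \<alpha> (f y))"
    if "Vector_Spaces.linear scale scale f" for f
    using Vector_Spaces.linear_compose[OF that linear_axioms] by (simp add: comp_def)
  then show ?thesis
    using assms even_linear
    by (simp add: color_hom_algebra_def even_bilinear_def even_linear_def)
qed

lemma twist_comm_hom_assoc:
  assumes "comm_hom_assoc_color_hom_algebra scale A m eps id"
    and mult: "homogeneous_multiplicative A m \<alpha>"
  shows "comm_hom_assoc_color_hom_algebra scale A (\<lambda>x y. \<alpha> (m x y)) eps \<alpha>"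
proof -
  have m: "color_hom_algebra scale A m eps id"
    and assoc: "\<And>a b c x y z. x \<in> A a \<Longrightarrow> y \<in> A b \<Longrightarrow> z \<in> A c \<Longrightarrow> m x (m y z) = m (m x y) z"
    and comm: "\<And>a b x y. x \<in> A a \<Longrightarrow> y \<in> A b \<Longrightarrow> m x y = scale (eps a b) (m y x)"
    using assms(1) unfolding comm_hom_assoc_color_hom_algebra_def id_apply by blast+
  have bil: "even_bilinear scale A m"
    using m by (simp add: color_hom_algebra_def)
  note nested = homogeneous_multiplicative_nested[OF mult bil]
  show ?thesis
    unfolding comm_hom_assoc_color_hom_algebra_def
  proof (intro conjI allI ballI twist_color_hom_algebra[OF m])
    fix a b c x y z assume h: "x \<in> A a" "y \<in> A b" "z \<in> A c"
    show "\<alpha> (m (\<alpha> x) (\<alpha> (m y z))) = \<alpha> (m (\<alpha> (m x y)) (\<alpha> z))"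
      unfolding nested[OF h] assoc[OF h] ..
  next
    fix a b x y assume h: "x \<in> A a" "y \<in> A b"
    show "\<alpha> (m x y) = scale (eps a b) (\<alpha> (m y x))"
      by (subst comm[OF h]) (rule scale)
  qed
qed

lemma twist_hom_novikov:
  assumes "hom_novikov_color_hom_algebra scale A d eps id"
    and mult: "homogeneous_multiplicative A d \<alpha>"
  shows "hom_novikov_color_hom_algebra scale A (\<lambda>x y. \<alpha> (d x y)) eps \<alpha>"
proof -
  have d: "color_hom_algebra scale A d eps id"
    and left_sym: "\<And>a b c x y z. x \<in> A a \<Longrightarrow> y \<in> A b \<Longrightarrow> z \<in> A c \<Longrightarrow>
      d (d x y) z - d x (d y z) = scale (eps a b) (d (d y x) z - d y (d x z))"
    and right_comm: "\<And>a b c x y z. x \<in> A a \<Longrightarrow> y \<in> A b \<Longrightarrow> z \<in> A c \<Longrightarrow>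
      d (d x y) z = scale (eps b c) (d (d x z) y)"
    using assms(1) unfolding hom_novikov_color_hom_algebra_def id_apply by blast+
  have bil: "even_bilinear scale A d"
    using d by (simp add: color_hom_algebra_def)
  note nested = homogeneous_multiplicative_nested[OF mult bil]
  show ?thesis
    unfolding hom_novikov_color_hom_algebra_def
  proof (intro conjI allI ballI twist_color_hom_algebra[OF d])
    fix a b c x y z assume h: "x \<in> A a" "y \<in> A b" "z \<in> A c"
    show "\<alpha> (d (\<alpha> (d x y)) (\<alpha> z)) - \<alpha> (d (\<alpha> x) (\<alpha> (d y z))) =
        scale (eps a b) (\<alpha> (d (\<alpha> (d y x)) (\<alpha> z)) - \<alpha> (d (\<alpha> y) (\<alpha> (d x z))))"
      \<comment> \<open>The swapped instance handles the terms in the order y, x, z. The reversed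
        linearity rules then gather each side under \<alpha> \<circ> \<alpha>, where the untwisted
        identity applies.\<close>
      unfolding nested[OF h] nested[OF h(2,1,3)]
      by (simp only: diff[symmetric] scale[symmetric] left_sym[OF h])
    show "\<alpha> (d (\<alpha> (d x y)) (\<alpha> z)) = scale (eps b c) (\<alpha> (d (\<alpha> (d x z)) (\<alpha> y)))"
      unfolding nested[OF h] nested[OF h(1,3,2)]
      by (simp only: scale[symmetric] right_comm[OF h])
  qed
qed

lemma twist_hom_novikov_poisson:
  assumes "hom_novikov_poisson_color_hom_algebra scale A m d eps id"
    and mult: "homogeneous_multiplicative A m \<alpha>" "homogeneous_multiplicative A d \<alpha>"
  shows "hom_novikov_poisson_color_hom_algebra scale A
           (\<lambda>x y. \<alpha> (m x y)) (\<lambda>x y. \<alpha> (d x y)) eps \<alpha>"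
proof -
  have m: "comm_hom_assoc_color_hom_algebra scale A m eps id"
    and d: "hom_novikov_color_hom_algebra scale A d eps id"
    and compat1: "\<And>a b c x y z. x \<in> A a \<Longrightarrow> y \<in> A b \<Longrightarrow> z \<in> A c \<Longrightarrow>
      d (m x y) z = scale (eps b c) (m (d x z) y)"
    and compat2: "\<And>a b c x y z. x \<in> A a \<Longrightarrow> y \<in> A b \<Longrightarrow> z \<in> A c \<Longrightarrow>
      m (d x y) z - d x (m y z) = scale (eps a b) (m (d y x) z - d y (m x z))"
    using assms(1) unfolding hom_novikov_poisson_color_hom_algebra_def id_apply by blast+
  have bil: "even_bilinear scale A m" "even_bilinear scale A d"
    using m d by (simp_all add: comm_hom_assoc_color_hom_algebra_def
        hom_novikov_color_hom_algebra_def color_hom_algebra_def)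
  \<comment> \<open>The compatibility axioms nest \<open>d\<close> inside \<open>m\<close> and
    \<open>m\<close> inside \<open>d\<close>; each case combines multiplicativity for the outer
    operation with evenness of the inner one.\<close>
  note nested = homogeneous_multiplicative_nested[OF mult(1) bil(2)]
    homogeneous_multiplicative_nested[OF mult(2) bil(1)]
  show ?thesis
    unfolding hom_novikov_poisson_color_hom_algebra_def
  proof (intro conjI allI ballI twist_comm_hom_assoc[OF m mult(1)] twist_hom_novikov[OF d mult(2)])
    fix a b c x y z assume h: "x \<in> A a" "y \<in> A b" "z \<in> A c"
    show "\<alpha> (d (\<alpha> (m x y)) (\<alpha> z)) = scale (eps b c) (\<alpha> (m (\<alpha> (d x z)) (\<alpha> y)))"
      unfolding nested[OF h] nested[OF h(1,3,2)]
      by (simp only: scale[symmetric] compat1[OF h])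
    show "\<alpha> (m (\<alpha> (d x y)) (\<alpha> z)) - \<alpha> (d (\<alpha> x) (\<alpha> (m y z))) =
        scale (eps a b) (\<alpha> (m (\<alpha> (d y x)) (\<alpha> z)) - \<alpha> (d (\<alpha> y) (\<alpha> (m x z))))"
      unfolding nested[OF h] nested[OF h(2,1,3)]
      by (simp only: diff[symmetric] scale[symmetric] compat2[OF h])
  qed
qed

lemma twist_hom_lie:
  assumes "hom_lie_color_hom_algebra scale A br eps id"
    and mult: "homogeneous_multiplicative A br \<alpha>"
  shows "hom_lie_color_hom_algebra scale A (\<lambda>x y. \<alpha> (br x y)) eps \<alpha>"
proof -
  have br: "color_hom_algebra scale A br eps id"
    and skew: "\<And>a b x y. x \<in> A a \<Longrightarrow> y \<in> A b \<Longrightarrow> br x y = - scale (eps a b) (br y x)"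
    and jacobi: "\<And>a b c x y z. x \<in> A a \<Longrightarrow> y \<in> A b \<Longrightarrow> z \<in> A c \<Longrightarrow>
      scale (eps c a) (br x (br y z)) + scale (eps a b) (br y (br z x)) +
      scale (eps b c) (br z (br x y)) = 0"
    using assms(1) unfolding hom_lie_color_hom_algebra_def id_apply by blast+
  have bil: "even_bilinear scale A br"
    using br by (simp add: color_hom_algebra_def)
  note nested = homogeneous_multiplicative_nested[OF mult bil]
  show ?thesis
    unfolding hom_lie_color_hom_algebra_def
  proof (intro conjI allI ballI twist_color_hom_algebra[OF br])
    fix a b x y assume h: "x \<in> A a" "y \<in> A b"
    show "\<alpha> (br x y) = - scale (eps a b) (\<alpha> (br y x))"
      by (subst skew[OF h]) (simp only: neg scale)
  next
    fix a b c x y z assume h: "x \<in> A a" "y \<in> A b" "z \<in> A c"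
    show "scale (eps c a) (\<alpha> (br (\<alpha> x) (\<alpha> (br y z)))) +
        scale (eps a b) (\<alpha> (br (\<alpha> y) (\<alpha> (br z x)))) +
        scale (eps b c) (\<alpha> (br (\<alpha> z) (\<alpha> (br x y)))) = 0"
      \<comment> \<open>One instance per cyclic rotation; the sum becomes \<alpha> \<circ> \<alpha>
        of the untwisted Jacobi sum, hence of 0.\<close>
      unfolding nested[OF h] nested[OF h(2,3,1)] nested[OF h(3,1,2)]
      by (simp only: scale[symmetric] add[symmetric] jacobi[OF h] zero)
  qed
qed

lemma twist_hom_poisson:
  assumes "hom_poisson_color_hom_algebra scale A m br eps id"
    and mult: "homogeneous_multiplicative A m \<alpha>" "homogeneous_multiplicative A br \<alpha>"
  shows "hom_poisson_color_hom_algebra scale A (\<lambda>x y. \<alpha> (m x y)) (\<lambda>x y. \<alpha> (br x y)) eps \<alpha>"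
proof -
  have m: "comm_hom_assoc_color_hom_algebra scale A m eps id"
    and br: "hom_lie_color_hom_algebra scale A br eps id"
    and leibniz: "\<And>a b c x y z. x \<in> A a \<Longrightarrow> y \<in> A b \<Longrightarrow> z \<in> A c \<Longrightarrow>
      br x (m y z) = scale (eps a b) (m y (br x z)) + scale (eps (a + b) c) (m z (br x y))"
    using assms(1) unfolding hom_poisson_color_hom_algebra_def id_apply by blast+
  have bil: "even_bilinear scale A m" "even_bilinear scale A br"
    using m br by (simp_all add: comm_hom_assoc_color_hom_algebra_def
        hom_lie_color_hom_algebra_def color_hom_algebra_def)
  note nested = homogeneous_multiplicative_nested[OF mult(1) bil(2)]
    homogeneous_multiplicative_nested[OF mult(2) bil(1)]
  show ?thesis
    unfolding hom_poisson_color_hom_algebra_def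
  proof (intro conjI allI ballI twist_comm_hom_assoc[OF m mult(1)] twist_hom_lie[OF br mult(2)])
    fix a b c x y z assume h: "x \<in> A a" "y \<in> A b" "z \<in> A c"
    show "\<alpha> (br (\<alpha> x) (\<alpha> (m y z))) =
        scale (eps a b) (\<alpha> (m (\<alpha> y) (\<alpha> (br x z)))) +
        scale (eps (a + b) c) (\<alpha> (m (\<alpha> z) (\<alpha> (br x y))))"
      \<comment> \<open>The first instance treats the left side, with outer bracket; the other two
        treat the terms on the right, with outer product \<open>m\<close> and leading factor y or
        z.\<close>
      unfolding nested[OF h] nested[OF h(2,1,3)] nested[OF h(3,1,2)]
      by (simp only: scale[symmetric] add[symmetric] leibniz[OF h])
  qed
qed

text \<open>The components of the arguments depend on the grading alone, so twisting
  \<open>d\<close> changes neither index set, and linearity moves \<alpha> out of the double sum. As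
  an equality of functions on all of the space it can rewrite the bracket inside the Hom-Poisson
  predicate.\<close>

lemma color_commutator_twist:
  "color_commutator scale A (\<lambda>x y. \<alpha> (d x y)) eps = (\<lambda>x y. \<alpha> (color_commutator scale A d eps x y))"
  by (intro ext) (simp add: color_commutator_def sum diff scale)

lemma color_commutator_multiplicative:
  assumes "graded_space scale A" and "even_bilinear scale A d"
    and "homogeneous_multiplicative A d \<alpha>"
  shows "homogeneous_multiplicative A (color_commutator scale A d eps) \<alpha>"
  unfolding homogeneous_multiplicative_def
proof (intro allI ballI)
  fix a b x y assume h: "x \<in> A a" "y \<in> A b"
  \<comment> \<open>Evenness keeps the degrees, so the same factor \<open>eps a b\<close> occurs in
    the brackets before and after applying \<alpha>.\<close>
  then have \<alpha>h: "\<alpha> x \<in> A a" "\<alpha> y \<in> A b"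
    using even_linear by (simp_all add: even_linear_def)
  have "\<alpha> (d x y) = d (\<alpha> x) (\<alpha> y)" "\<alpha> (d y x) = d (\<alpha> y) (\<alpha> x)"
    using assms(3) h unfolding homogeneous_multiplicative_def by blast+
  then show "\<alpha> (color_commutator scale A d eps x y) =
      color_commutator scale A d eps (\<alpha> x) (\<alpha> y)"
    by (simp only: color_commutator_homogeneous[OF assms(1,2) h]
        color_commutator_homogeneous[OF assms(1,2) \<alpha>h] diff scale)
qed

end

theorem theorem3p19:
  fixes scale :: "'k::{alg_closed_field, field_char_0} \<Rightarrow> 'a::ab_group_add \<Rightarrow> 'a"
    and A :: "'g::ab_group_add \<Rightarrow> 'a set"
    and m d :: "'a \<Rightarrow> 'a \<Rightarrow> 'a"
    and eps :: "'g \<Rightarrow> 'g \<Rightarrow> 'k"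
    and \<alpha> :: "'a \<Rightarrow> 'a"
  assumes "admissible_novikov_poisson_color_hom_algebra scale A m d eps"
    and "novikov_poisson_morphism scale A m d scale A m d \<alpha>"
  shows "admissible_hom_novikov_poisson_color_hom_algebra scale A
           (\<lambda>x y. \<alpha> (m x y)) (\<lambda>x y. \<alpha> (d x y)) eps \<alpha>"
proof -
  interpret even_endomorphism scale A \<alpha>
    using assms(2) by unfold_locales (simp add: novikov_poisson_morphism_def)
  have mult: "homogeneous_multiplicative A m \<alpha>" "homogeneous_multiplicative A d \<alpha>"
    using assms(2) by (simp_all add: novikov_poisson_morphism_def homogeneous_multiplicative_def)
  have np: "hom_novikov_poisson_color_hom_algebra scale A m d eps id"
    and poisson: "hom_poisson_color_hom_algebra scale A m (color_commutator scale A d eps) eps id"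
    using assms(1) by (simp_all add: admissible_novikov_poisson_color_hom_algebra_def
        admissible_hom_novikov_poisson_color_hom_algebra_def)
  have "graded_space scale A" and "even_bilinear scale A d"
    using np by (simp_all add: hom_novikov_poisson_color_hom_algebra_def
        hom_novikov_color_hom_algebra_def color_hom_algebra_def)
  then have "homogeneous_multiplicative A (color_commutator scale A d eps) \<alpha>"
    by (rule color_commutator_multiplicative[OF _ _ mult(2)])
  then show ?thesis
    \<comment> \<open>Admissibility asks for the commutator of the twisted \<open>d\<close>;
      rewriting it as \<alpha> after the old bracket gives the form delivered by
      \<open>twist_hom_poisson\<close>.\<close>
    unfolding admissible_hom_novikov_poisson_color_hom_algebra_def color_commutator_twist
    using twist_hom_novikov_poisson[OF np mult] twist_hom_poisson[OF poisson mult(1)] by simp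
qed

end
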